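(* Let $\mathbb K$ be a field and let $\mathcal P$ be an operad in $\mathbb K$-vector spaces with $\mathcal P(0)=0$ and $\mathcal P(1)=\mathbb K\cdot \mathrm{id}$ (with $\mathrm{id}\neq 0$). Then the pre-Lie algebra $\big(\bigoplus_{n\ge 1}\mathcal P(n),\triangleleft\big)$, where $\mu\triangleleft\nu=\sum_{i=1}^n\mu\circ_i\nu$ for $\mu\in\mathcal P(n)$, $\nu\in\mathcal P(m)$, is not free as a pre-Lie algebra; that is, there is no $\mathbb K$-vector space $V$ such that $\big(\bigoplus_{n\ge 1}\mathcal P(n),\triangleleft\big)$ is isomorphic, as a pre-Lie algebra, to the free pre-Lie algebra on $V$.
   Context: A (right) pre-Lie algebra over a field $\mathbb K$ is a $\mathbb K$-vector space $V$ together with a bilinear map $\triangleleft:V\otimes V\to V$ satisfying, for all $x,y,z\in V$, $$(x\triangleleft y)\triangleleft z-x\triangleleft(y\triangleleft z)=(x\triangleleft z)\triangleleft y-x\triangleleft(z\triangleleft y).$$ The free pre-Lie algebra on a vector space $V$ is the value at $V$ of the left adjoint of the forgetful functor from pre-Lie algebras to vector spaces. An operad $\mathcal P$ is a collection of $\mathbb S_n$-modules $\mathcal P(n)$ over $\mathbb K$ (where $\mathbb S_n$ is the symmetric group), an element $\mathrm{id}\in\mathcal P(1)$, and linear partial compositions $\circ_i:\mathcal P(n)\otimes\mathcal P(m)\to\mathcal P(n+m-1)$, $1\le i\le n$ (where $\mu\circ_i\nu$ is the substitution of $\nu$ into the $i$-th entry of $\mu$), compatible with the symmetric group actions in the usual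 sense and satisfying, for all $\lambda\in\mathcal P(l)$, $\mu\in\mathcal P(m)$, $\nu\in\mathcal P(n)$: (1) $(\lambda\circ_i\mu)\circ_{i-1+j}\nu=\lambda\circ_i(\mu\circ_j\nu)$ for $1\le i\le l$, $1\le j\le m$; (2) $(\lambda\circ_i\mu)\circ_{k-1+m}\nu=(\lambda\circ_k\nu)\circ_i\mu$ for $1\le i<k\le l$; (3) $\mathrm{id}\circ_1\nu=\nu$ and $\mu\circ_i\mathrm{id}=\mu$ for $1\le i\le m$. The product $\mu\triangleleft\nu=\sum_{i=1}^n\mu\circ_i\nu$ ($\mu\in\mathcal P(n)$, $\nu\in\mathcal P(m)$), extended bilinearly, makes $\bigoplus_{n\ge1}\mathcal P(n)$ a pre-Lie algebra. *)

theory Defs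
  imports "HOL-Algebra.Module" "HOL-Combinatorics.Permutations"
begin

section \<open>Linear maps and pre-Lie algebras\<close>

text \<open>
  Vector spaces over a field \<open>K\<close> are modules in the sense of \<^locale>\<open>module\<close>.  In a module record
  the field \<open>mult\<close> plays no role for the module structure; below it carries the pre-Lie product.
  The field \<open>one\<close> is never used.
\<close>

definition linear_map :: "('k, 'q) ring_scheme \<Rightarrow> ('k, 'a, 'x) module_scheme \<Rightarrow>
    ('k, 'b, 'y) module_scheme \<Rightarrow> ('a \<Rightarrow> 'b) \<Rightarrow> bool" where
  "linear_map K V W f \<longleftrightarrow>
     f \<in> carrier V \<rightarrow> carrier W \<and>
     (\<forall>x\<in>carrier V. \<forall>y\<in>carrier V. f (x \<oplus>\<^bsub>V\<^esub> y) = f x \<oplus>\<^bsub>W\<^esub> f y) \<and>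
     (\<forall>c\<in>carrier K. \<forall>x\<in>carrier V. f (c \<odot>\<^bsub>V\<^esub> x) = c \<odot>\<^bsub>W\<^esub> f x)"

definition bilinear_map :: "('k, 'q) ring_scheme \<Rightarrow> ('k, 'a, 'x) module_scheme \<Rightarrow>
    ('k, 'b, 'y) module_scheme \<Rightarrow> ('k, 'c, 'z) module_scheme \<Rightarrow> ('a \<Rightarrow> 'b \<Rightarrow> 'c) \<Rightarrow> bool" where
  "bilinear_map K U V W b \<longleftrightarrow>
     (\<forall>x\<in>carrier U. linear_map K V W (\<lambda>y. b x y)) \<and>
     (\<forall>y\<in>carrier V. linear_map K U W (\<lambda>x. b x y))"

locale prelie_algebra = field K + module K A for K (structure) and A (structure) +
  assumes prelie_bilinear: "bilinear_map K A A A (\<lambda>x y. x \<otimes>\<^bsub>A\<^esub> y)"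
    and prelie_identity:
      "\<lbrakk>x \<in> carrier A; y \<in> carrier A; z \<in> carrier A\<rbrakk> \<Longrightarrow>
        ((x \<otimes>\<^bsub>A\<^esub> y) \<otimes>\<^bsub>A\<^esub> z) \<ominus>\<^bsub>A\<^esub> (x \<otimes>\<^bsub>A\<^esub> (y \<otimes>\<^bsub>A\<^esub> z))
        = ((x \<otimes>\<^bsub>A\<^esub> z) \<otimes>\<^bsub>A\<^esub> y) \<ominus>\<^bsub>A\<^esub> (x \<otimes>\<^bsub>A\<^esub> (z \<otimes>\<^bsub>A\<^esub> y))"

definition prelie_hom :: "('k, 'q) ring_scheme \<Rightarrow> ('k, 'a, 'x) module_scheme \<Rightarrow>
    ('k, 'b, 'y) module_scheme \<Rightarrow> ('a \<Rightarrow> 'b) \<Rightarrow> bool" where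
  "prelie_hom K A B f \<longleftrightarrow> linear_map K A B f \<and>
     (\<forall>x\<in>carrier A. \<forall>y\<in>carrier A. f (x \<otimes>\<^bsub>A\<^esub> y) = f x \<otimes>\<^bsub>B\<^esub> f y)"

definition prelie_isomorphic :: "('k, 'q) ring_scheme \<Rightarrow> ('k, 'a, 'x) module_scheme \<Rightarrow>
    ('k, 'b, 'y) module_scheme \<Rightarrow> bool" where
  "prelie_isomorphic K A B \<longleftrightarrow>
     (\<exists>f. prelie_hom K A B f \<and> bij_betw f (carrier A) (carrier B))"


section \<open>The free pre-Lie algebra on a vector space\<close>

text \<open>
  The free pre-Lie algebra on \<open>V\<close> is presented by generators and relations: formal expressions in the
  elements of \<open>V\<close>, modulo the smallest congruence that forces the axioms of a pre-Lie algebra and the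
  linearity of \<open>V \<rightarrow> F(V)\<close>.  That this is the value at \<open>V\<close> of the left adjoint of the
  forgetful functor is shown by theorems \<open>free_prelie_universal_exists\<close> and
  \<open>free_prelie_universal_unique\<close> below, where the target algebra may have any carrier type.
\<close>

datatype ('k, 'v) pterm =
    Gen 'v
  | Zero
  | Add "('k, 'v) pterm" "('k, 'v) pterm"
  | Scale 'k "('k, 'v) pterm"
  | Prod "('k, 'v) pterm" "('k, 'v) pterm"

inductive_set pterms :: "('k, 'q) ring_scheme \<Rightarrow> ('k, 'v, 'x) module_scheme \<Rightarrow> ('k, 'v) pterm set"
  for K V where
  "v \<in> carrier V \<Longrightarrow> Gen v \<in> pterms K V"
| "Zero \<in> pterms K V"
| "s \<in> pterms K V \<Longrightarrow> t \<in> pterms K V \<Longrightarrow> Add s t \<in> pterms K V"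
| "c \<in> carrier K \<Longrightarrow> t \<in> pterms K V \<Longrightarrow> Scale c t \<in> pterms K V"
| "s \<in> pterms K V \<Longrightarrow> t \<in> pterms K V \<Longrightarrow> Prod s t \<in> pterms K V"

abbreviation (input) "Sub K s t \<equiv> Add s (Scale (\<ominus>\<^bsub>K\<^esub> \<one>\<^bsub>K\<^esub>) t)"

inductive pcong :: "('k, 'q) ring_scheme \<Rightarrow> ('k, 'v, 'x) module_scheme \<Rightarrow>
    ('k, 'v) pterm \<Rightarrow> ('k, 'v) pterm \<Rightarrow> bool" for K V where
  pc_refl: "t \<in> pterms K V \<Longrightarrow> pcong K V t t"
| pc_sym: "pcong K V s t \<Longrightarrow> pcong K V t s"
| pc_trans: "pcong K V s t \<Longrightarrow> pcong K V t u \<Longrightarrow> pcong K V s u"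
| pc_Add: "pcong K V s s' \<Longrightarrow> pcong K V t t' \<Longrightarrow> pcong K V (Add s t) (Add s' t')"
| pc_Scale: "c \<in> carrier K \<Longrightarrow> pcong K V t t' \<Longrightarrow> pcong K V (Scale c t) (Scale c t')"
| pc_Prod: "pcong K V s s' \<Longrightarrow> pcong K V t t' \<Longrightarrow> pcong K V (Prod s t) (Prod s' t')"
(* vector space axioms; additive inverses come from scale_0 *)
| add_assoc: "\<lbrakk>s \<in> pterms K V; t \<in> pterms K V; u \<in> pterms K V\<rbrakk> \<Longrightarrow>
    pcong K V (Add (Add s t) u) (Add s (Add t u))"
| add_comm: "\<lbrakk>s \<in> pterms K V; t \<in> pterms K V\<rbrakk> \<Longrightarrow> pcong K V (Add s t) (Add t s)"
| add_0: "t \<in> pterms K V \<Longrightarrow> pcong K V (Add Zero t) t"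
| scale_0: "t \<in> pterms K V \<Longrightarrow> pcong K V (Scale \<zero>\<^bsub>K\<^esub> t) Zero"
| scale_1: "t \<in> pterms K V \<Longrightarrow> pcong K V (Scale \<one>\<^bsub>K\<^esub> t) t"
| scale_scale: "\<lbrakk>c \<in> carrier K; d \<in> carrier K; t \<in> pterms K V\<rbrakk> \<Longrightarrow>
    pcong K V (Scale c (Scale d t)) (Scale (c \<otimes>\<^bsub>K\<^esub> d) t)"
| scale_add_left: "\<lbrakk>c \<in> carrier K; d \<in> carrier K; t \<in> pterms K V\<rbrakk> \<Longrightarrow>
    pcong K V (Scale (c \<oplus>\<^bsub>K\<^esub> d) t) (Add (Scale c t) (Scale d t))"
| scale_add_right: "\<lbrakk>c \<in> carrier K; s \<in> pterms K V; t \<in> pterms K V\<rbrakk> \<Longrightarrow>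
    pcong K V (Scale c (Add s t)) (Add (Scale c s) (Scale c t))"
(* bilinearity of the product *)
| prod_add_left: "\<lbrakk>s \<in> pterms K V; t \<in> pterms K V; u \<in> pterms K V\<rbrakk> \<Longrightarrow>
    pcong K V (Prod (Add s t) u) (Add (Prod s u) (Prod t u))"
| prod_add_right: "\<lbrakk>s \<in> pterms K V; t \<in> pterms K V; u \<in> pterms K V\<rbrakk> \<Longrightarrow>
    pcong K V (Prod u (Add s t)) (Add (Prod u s) (Prod u t))"
| prod_scale_left: "\<lbrakk>c \<in> carrier K; s \<in> pterms K V; t \<in> pterms K V\<rbrakk> \<Longrightarrow>
    pcong K V (Prod (Scale c s) t) (Scale c (Prod s t))"
| prod_scale_right: "\<lbrakk>c \<in> carrier K; s \<in> pterms K V; t \<in> pterms K V\<rbrakk> \<Longrightarrow>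
    pcong K V (Prod s (Scale c t)) (Scale c (Prod s t))"
(* the pre-Lie identity *)
| prelie: "\<lbrakk>s \<in> pterms K V; t \<in> pterms K V; u \<in> pterms K V\<rbrakk> \<Longrightarrow>
    pcong K V (Sub K (Prod (Prod s t) u) (Prod s (Prod t u)))
              (Sub K (Prod (Prod s u) t) (Prod s (Prod u t)))"
(* linearity of the inclusion of generators *)
| gen_add: "\<lbrakk>v \<in> carrier V; w \<in> carrier V\<rbrakk> \<Longrightarrow>
    pcong K V (Gen (v \<oplus>\<^bsub>V\<^esub> w)) (Add (Gen v) (Gen w))"
| gen_scale: "\<lbrakk>c \<in> carrier K; v \<in> carrier V\<rbrakk> \<Longrightarrow>
    pcong K V (Gen (c \<odot>\<^bsub>V\<^esub> v)) (Scale c (Gen v))"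

definition pclass :: "('k, 'q) ring_scheme \<Rightarrow> ('k, 'v, 'x) module_scheme \<Rightarrow>
    ('k, 'v) pterm \<Rightarrow> ('k, 'v) pterm set" where
  "pclass K V t = {s. pcong K V t s}"

definition free_prelie :: "('k, 'q) ring_scheme \<Rightarrow> ('k, 'v, 'x) module_scheme \<Rightarrow>
    ('k, ('k, 'v) pterm set) module" where
  "free_prelie K V =
     \<lparr>carrier = pclass K V ` pterms K V,
      monoid.mult = (\<lambda>X Y. \<Union>s\<in>X. \<Union>t\<in>Y. pclass K V (Prod s t)),
      one = undefined,
      zero = pclass K V Zero,
      add = (\<lambda>X Y. \<Union>s\<in>X. \<Union>t\<in>Y. pclass K V (Add s t)),
      smult = (\<lambda>c X. \<Union>t\<in>X. pclass K V (Scale c t))\<rparr>"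

definition free_prelie_gen :: "('k, 'q) ring_scheme \<Rightarrow> ('k, 'v, 'x) module_scheme \<Rightarrow>
    'v \<Rightarrow> ('k, 'v) pterm set" where
  "free_prelie_gen K V v = pclass K V (Gen v)"

lemma pcong_pterms:
  assumes "field K" "module K V" "pcong K V s t"
  shows "s \<in> pterms K V \<and> t \<in> pterms K V"
proof -
  interpret field K by fact
  interpret V: module K V by fact
  show ?thesis using assms(3)
    by induction (auto intro!: pterms.intros)
qed

context
  fixes K :: "('k, 'q) ring_scheme" and V :: "('k, 'v, 'x) module_scheme"
  assumes K: "field K" and V: "module K V"
begin

interpretation field K by (rule K)
interpretation V: module K V by (rule V)

lemma pclass_eq:
  assumes "pcong K V s t"
  shows "pclass K V s = pclass K V t"
proof -
  have "pcong K V s u \<longleftrightarrow> pcong K V t u" for u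
    using pc_trans[OF assms, of u] pc_trans[OF pc_sym[OF assms], of u] by blast
  then show ?thesis by (simp add: pclass_def)
qed

lemma pclass_eq_iff:
  assumes "t \<in> pterms K V"
  shows "pclass K V s = pclass K V t \<longleftrightarrow> pcong K V s t"
proof
  assume "pclass K V s = pclass K V t"
  moreover have "t \<in> pclass K V t" using assms by (simp add: pclass_def pc_refl)
  ultimately have "t \<in> pclass K V s" by (simp only:)
  then show "pcong K V s t" by (simp add: pclass_def)
qed (rule pclass_eq)

lemma free_prelie_add:
  assumes "s \<in> pterms K V" "t \<in> pterms K V"
  shows "pclass K V s \<oplus>\<^bsub>free_prelie K V\<^esub> pclass K V t = pclass K V (Add s t)"
proof -
  have "pclass K V (Add s' t') = pclass K V (Add s t)"
    if "s' \<in> pclass K V s" "t' \<in> pclass K V t" for s' t'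
    using that by (intro pclass_eq pc_Add) (simp_all add: pclass_def pc_sym)
  moreover have "s \<in> pclass K V s" "t \<in> pclass K V t"
    using assms by (simp_all add: pclass_def pc_refl)
  ultimately have "(\<Union>s'\<in>pclass K V s. \<Union>t'\<in>pclass K V t. pclass K V (Add s' t'))
      = pclass K V (Add s t)" by blast
  then show ?thesis by (simp add: free_prelie_def)
qed

lemma free_prelie_mult:
  assumes "s \<in> pterms K V" "t \<in> pterms K V"
  shows "pclass K V s \<otimes>\<^bsub>free_prelie K V\<^esub> pclass K V t = pclass K V (Prod s t)"
proof -
  have "pclass K V (Prod s' t') = pclass K V (Prod s t)"
    if "s' \<in> pclass K V s" "t' \<in> pclass K V t" for s' t'
    using that by (intro pclass_eq pc_Prod) (simp_all add: pclass_def pc_sym)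
  moreover have "s \<in> pclass K V s" "t \<in> pclass K V t"
    using assms by (simp_all add: pclass_def pc_refl)
  ultimately have "(\<Union>s'\<in>pclass K V s. \<Union>t'\<in>pclass K V t. pclass K V (Prod s' t'))
      = pclass K V (Prod s t)" by blast
  then show ?thesis by (simp add: free_prelie_def)
qed

lemma free_prelie_smult:
  assumes "c \<in> carrier K" "t \<in> pterms K V"
  shows "c \<odot>\<^bsub>free_prelie K V\<^esub> pclass K V t = pclass K V (Scale c t)"
proof -
  have "pclass K V (Scale c t') = pclass K V (Scale c t)" if "t' \<in> pclass K V t" for t'
    using that assms(1) by (intro pclass_eq pc_Scale) (simp_all add: pclass_def pc_sym)
  moreover have "t \<in> pclass K V t"
    using assms by (simp add: pclass_def pc_refl)
  ultimately have "(\<Union>t'\<in>pclass K V t. pclass K V (Scale c t')) = pclass K V (Scale c t)"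
    by blast
  then show ?thesis by (simp add: free_prelie_def)
qed

lemma free_prelie_zero: "\<zero>\<^bsub>free_prelie K V\<^esub> = pclass K V Zero"
  by (simp add: free_prelie_def)

lemma free_prelie_carrier: "carrier (free_prelie K V) = pclass K V ` pterms K V"
  by (simp add: free_prelie_def)

lemmas free_prelie_ops =
  free_prelie_add free_prelie_mult free_prelie_smult free_prelie_zero free_prelie_carrier

lemma free_prelie_module: "module K (free_prelie K V)"
proof -
  let ?F = "free_prelie K V"
  have inv: "pcong K V (Add (Scale (\<ominus>\<^bsub>K\<^esub> \<one>\<^bsub>K\<^esub>) t) t) Zero" if t: "t \<in> pterms K V" for t
  proof -
    have 1: "pcong K V (Add (Scale (\<ominus>\<^bsub>K\<^esub> \<one>\<^bsub>K\<^esub>) t) t) (Add (Scale (\<ominus>\<^bsub>K\<^esub> \<one>\<^bsub>K\<^esub>) t) (Scale \<one>\<^bsub>K\<^esub> t))"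
      using t by (auto intro!: pc_Add pc_refl pterms.intros pc_sym[OF scale_1])
    have 2: "pcong K V (Add (Scale (\<ominus>\<^bsub>K\<^esub> \<one>\<^bsub>K\<^esub>) t) (Scale \<one>\<^bsub>K\<^esub> t)) (Scale (\<ominus>\<^bsub>K\<^esub> \<one>\<^bsub>K\<^esub> \<oplus>\<^bsub>K\<^esub> \<one>\<^bsub>K\<^esub>) t)"
      using t by (auto intro!: pc_sym[OF scale_add_left])
    have 3: "pcong K V (Scale (\<ominus>\<^bsub>K\<^esub> \<one>\<^bsub>K\<^esub> \<oplus>\<^bsub>K\<^esub> \<one>\<^bsub>K\<^esub>) t) Zero"
      using t by (simp add: l_neg scale_0)
    show ?thesis by (rule pc_trans[OF 1 pc_trans[OF 2 3]])
  qed
  have "abelian_group ?F"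
  proof (rule abelian_groupI)
    fix x y z assume "x \<in> carrier ?F" "y \<in> carrier ?F" "z \<in> carrier ?F"
    then show "(x \<oplus>\<^bsub>?F\<^esub> y) \<oplus>\<^bsub>?F\<^esub> z = x \<oplus>\<^bsub>?F\<^esub> (y \<oplus>\<^bsub>?F\<^esub> z)"
      by (auto simp: free_prelie_ops pclass_eq_iff pterms.intros intro!: add_assoc del: equalityI)
  next
    fix x y assume "x \<in> carrier ?F" "y \<in> carrier ?F"
    then show "x \<oplus>\<^bsub>?F\<^esub> y \<in> carrier ?F" "x \<oplus>\<^bsub>?F\<^esub> y = y \<oplus>\<^bsub>?F\<^esub> x"
      by (auto simp: free_prelie_ops pclass_eq_iff pterms.intros intro!: add_comm imageI del: equalityI)
  next
    fix x assume "x \<in> carrier ?F"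
    then obtain t where t: "t \<in> pterms K V" "x = pclass K V t"
      by (auto simp: free_prelie_ops)
    show "\<zero>\<^bsub>?F\<^esub> \<oplus>\<^bsub>?F\<^esub> x = x"
      using t by (auto simp: free_prelie_ops pclass_eq_iff pterms.intros intro!: imageI add_0 del: equalityI)
    show "\<exists>y\<in>carrier ?F. y \<oplus>\<^bsub>?F\<^esub> x = \<zero>\<^bsub>?F\<^esub>"
      using t inv[OF t(1)]
      by (intro bexI[of _ "pclass K V (Scale (\<ominus>\<^bsub>K\<^esub> \<one>\<^bsub>K\<^esub>) t)"])
         (auto simp: free_prelie_ops pclass_eq_iff pterms.intros)
  qed (auto simp: free_prelie_ops pclass_eq_iff pterms.intros)
  then show ?thesis
  proof (rule moduleI[OF is_cring])
    fix c d x assume "c \<in> carrier K" "d \<in> carrier K" "x \<in> carrier ?F"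
    then show "(c \<oplus>\<^bsub>K\<^esub> d) \<odot>\<^bsub>?F\<^esub> x = c \<odot>\<^bsub>?F\<^esub> x \<oplus>\<^bsub>?F\<^esub> d \<odot>\<^bsub>?F\<^esub> x"
      and "(c \<otimes>\<^bsub>K\<^esub> d) \<odot>\<^bsub>?F\<^esub> x = c \<odot>\<^bsub>?F\<^esub> (d \<odot>\<^bsub>?F\<^esub> x)"
      by (auto simp: free_prelie_ops pclass_eq_iff pterms.intros
          intro!: scale_add_left pc_sym[OF scale_scale] del: equalityI)
  next
    fix c x y assume "c \<in> carrier K" "x \<in> carrier ?F" "y \<in> carrier ?F"
    then show "c \<odot>\<^bsub>?F\<^esub> (x \<oplus>\<^bsub>?F\<^esub> y) = c \<odot>\<^bsub>?F\<^esub> x \<oplus>\<^bsub>?F\<^esub> c \<odot>\<^bsub>?F\<^esub> y"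
      by (auto simp: free_prelie_ops pclass_eq_iff pterms.intros intro!: scale_add_right del: equalityI)
  qed (auto simp: free_prelie_ops pclass_eq_iff pterms.intros intro!: imageI scale_1 del: equalityI)
qed

lemma module_minus_conv:
  fixes M :: "('k, 'm, 'y) module_scheme"
  assumes "module K M" "x \<in> carrier M" "y \<in> carrier M"
  shows "x \<ominus>\<^bsub>M\<^esub> y = x \<oplus>\<^bsub>M\<^esub> ((\<ominus>\<^bsub>K\<^esub> \<one>\<^bsub>K\<^esub>) \<odot>\<^bsub>M\<^esub> y)"
proof -
  interpret M: module K M by fact
  show ?thesis using assms(2,3) by (simp add: a_minus_def M.smult_l_minus)
qed

theorem free_prelie_is_prelie: "prelie_algebra K (free_prelie K V)"
proof -
  let ?F = "free_prelie K V"
  interpret F: module K ?F by (rule free_prelie_module)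
  show ?thesis
  proof unfold_locales
    show "bilinear_map K ?F ?F ?F (\<lambda>x y. x \<otimes>\<^bsub>?F\<^esub> y)"
      unfolding bilinear_map_def linear_map_def
      by (auto simp: free_prelie_ops pclass_eq_iff pterms.intros
          intro!: imageI prod_add_left prod_add_right prod_scale_left prod_scale_right del: equalityI)
  next
    fix x y z assume xyz: "x \<in> carrier ?F" "y \<in> carrier ?F" "z \<in> carrier ?F"
    then obtain s t u where stu: "s \<in> pterms K V" "t \<in> pterms K V" "u \<in> pterms K V"
        "x = pclass K V s" "y = pclass K V t" "z = pclass K V u"
      by (auto simp: free_prelie_ops)
    have mem: "pclass K V r \<in> carrier ?F" if "r \<in> pterms K V" for r
      using that by (simp add: free_prelie_ops)
    show "((x \<otimes>\<^bsub>?F\<^esub> y) \<otimes>\<^bsub>?F\<^esub> z) \<ominus>\<^bsub>?F\<^esub> (x \<otimes>\<^bsub>?F\<^esub> (y \<otimes>\<^bsub>?F\<^esub> z))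
        = ((x \<otimes>\<^bsub>?F\<^esub> z) \<otimes>\<^bsub>?F\<^esub> y) \<ominus>\<^bsub>?F\<^esub> (x \<otimes>\<^bsub>?F\<^esub> (z \<otimes>\<^bsub>?F\<^esub> y))"
      using stu pclass_eq[OF prelie[OF stu(1,2,3)]]
      by (simp add: free_prelie_add free_prelie_mult free_prelie_smult pterms.intros mem
          module_minus_conv[OF free_prelie_module])
  qed
qed

theorem free_prelie_gen_linear: "linear_map K V (free_prelie K V) (free_prelie_gen K V)"
  unfolding linear_map_def free_prelie_gen_def
  by (auto simp: free_prelie_ops pclass_eq_iff pterms.intros intro!: imageI gen_add gen_scale del: equalityI)

end

primrec peval :: "('k, 'b, 'y) module_scheme \<Rightarrow> ('v \<Rightarrow> 'b) \<Rightarrow> ('k, 'v) pterm \<Rightarrow> 'b" where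
  "peval A f (Gen v) = f v"
| "peval A f Zero = \<zero>\<^bsub>A\<^esub>"
| "peval A f (Add s t) = peval A f s \<oplus>\<^bsub>A\<^esub> peval A f t"
| "peval A f (Scale c t) = c \<odot>\<^bsub>A\<^esub> peval A f t"
| "peval A f (Prod s t) = peval A f s \<otimes>\<^bsub>A\<^esub> peval A f t"

lemma prelie_algebra_bilinear:
  assumes "prelie_algebra K A"
  shows
    "\<And>x y. \<lbrakk>x \<in> carrier A; y \<in> carrier A\<rbrakk> \<Longrightarrow> x \<otimes>\<^bsub>A\<^esub> y \<in> carrier A"
    "\<And>x y z. \<lbrakk>x \<in> carrier A; y \<in> carrier A; z \<in> carrier A\<rbrakk> \<Longrightarrow>
      x \<otimes>\<^bsub>A\<^esub> (y \<oplus>\<^bsub>A\<^esub> z) = x \<otimes>\<^bsub>A\<^esub> y \<oplus>\<^bsub>A\<^esub> x \<otimes>\<^bsub>A\<^esub> z"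
    "\<And>x y z. \<lbrakk>x \<in> carrier A; y \<in> carrier A; z \<in> carrier A\<rbrakk> \<Longrightarrow>
      (x \<oplus>\<^bsub>A\<^esub> y) \<otimes>\<^bsub>A\<^esub> z = x \<otimes>\<^bsub>A\<^esub> z \<oplus>\<^bsub>A\<^esub> y \<otimes>\<^bsub>A\<^esub> z"
    "\<And>c x y. \<lbrakk>c \<in> carrier K; x \<in> carrier A; y \<in> carrier A\<rbrakk> \<Longrightarrow>
      (c \<odot>\<^bsub>A\<^esub> x) \<otimes>\<^bsub>A\<^esub> y = c \<odot>\<^bsub>A\<^esub> (x \<otimes>\<^bsub>A\<^esub> y)"
    "\<And>c x y. \<lbrakk>c \<in> carrier K; x \<in> carrier A; y \<in> carrier A\<rbrakk> \<Longrightarrow>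
      x \<otimes>\<^bsub>A\<^esub> (c \<odot>\<^bsub>A\<^esub> y) = c \<odot>\<^bsub>A\<^esub> (x \<otimes>\<^bsub>A\<^esub> y)"
  using prelie_algebra.prelie_bilinear[OF assms]
  unfolding bilinear_map_def linear_map_def by auto

lemma linear_map_zero:
  assumes "module K V" "module K W" "linear_map K V W f"
  shows "f \<zero>\<^bsub>V\<^esub> = \<zero>\<^bsub>W\<^esub>"
proof -
  interpret V: module K V by fact
  interpret W: module K W by fact
  have f0: "f \<zero>\<^bsub>V\<^esub> \<in> carrier W"
    using assms(3) V.M.zero_closed unfolding linear_map_def by blast
  have "f \<zero>\<^bsub>V\<^esub> = f (\<zero>\<^bsub>K\<^esub> \<odot>\<^bsub>V\<^esub> \<zero>\<^bsub>V\<^esub>)" by simp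
  also have "\<dots> = \<zero>\<^bsub>K\<^esub> \<odot>\<^bsub>W\<^esub> f \<zero>\<^bsub>V\<^esub>"
    using assms(3) V.M.zero_closed V.R.zero_closed unfolding linear_map_def by blast
  also have "\<dots> = \<zero>\<^bsub>W\<^esub>" using f0 by (rule W.smult_l_null)
  finally show ?thesis .
qed

context
  fixes K :: "('k, 'q) ring_scheme" and V :: "('k, 'v, 'x) module_scheme"
    and A :: "('k, 'b, 'y) module_scheme" and f :: "'v \<Rightarrow> 'b"
  assumes V: "module K V" and A: "prelie_algebra K A" and f: "linear_map K V A f"
begin

interpretation A: prelie_algebra K A by (rule A)
interpretation V: module K V by (rule V)

lemma f_simps:
  "v \<in> carrier V \<Longrightarrow> f v \<in> carrier A"
  "\<lbrakk>v \<in> carrier V; w \<in> carrier V\<rbrakk> \<Longrightarrow> f (v \<oplus>\<^bsub>V\<^esub> w) = f v \<oplus>\<^bsub>A\<^esub> f w"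
  "\<lbrakk>c \<in> carrier K; v \<in> carrier V\<rbrakk> \<Longrightarrow> f (c \<odot>\<^bsub>V\<^esub> v) = c \<odot>\<^bsub>A\<^esub> f v"
  using f unfolding linear_map_def by auto

lemmas bil = prelie_algebra_bilinear[OF A]

lemma peval_closed: "t \<in> pterms K V \<Longrightarrow> peval A f t \<in> carrier A"
  by (induction rule: pterms.induct) (auto simp: f_simps bil)

lemma peval_pcong: "pcong K V s t \<Longrightarrow> peval A f s = peval A f t"
proof (induction rule: pcong.induct)
  case (prelie s t u)
  then show ?case
    using A.prelie_identity[of "peval A f s" "peval A f t" "peval A f u"]
    by (simp add: peval_closed bil module_minus_conv[OF A.field_axioms V A.module_axioms])
next
  case (add_assoc s t u)
  then show ?case by (simp add: peval_closed A.a_assoc)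
next
  case (add_comm s t)
  then show ?case by (simp add: peval_closed A.a_comm)
qed (simp_all add: peval_closed bil f_simps A.smult_assoc1 A.smult_l_distr A.smult_r_distr)

theorem free_prelie_universal_exists:
  "\<exists>h. prelie_hom K (free_prelie K V) A h \<and> (\<forall>v\<in>carrier V. h (free_prelie_gen K V v) = f v)"
proof -
  note ops = free_prelie_ops[OF A.field_axioms V]
  define g where "g X = peval A f (SOME t. t \<in> X)" for X
  have g: "g (pclass K V t) = peval A f t" if "t \<in> pterms K V" for t
  proof -
    have "t \<in> pclass K V t" using that by (simp add: pclass_def pc_refl)
    then have "(SOME s. s \<in> pclass K V t) \<in> pclass K V t" by (rule someI)
    then have "pcong K V t (SOME s. s \<in> pclass K V t)"
      by (simp add: pclass_def)
    from peval_pcong[OF this] show ?thesis by (simp add: g_def)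
  qed
  have "linear_map K (free_prelie K V) A g"
    unfolding linear_map_def by (auto simp: ops g peval_closed pterms.intros)
  then show ?thesis
    by (intro exI[of _ g]) (auto simp: prelie_hom_def ops g pterms.intros free_prelie_gen_def)
qed

lemma prelie_hom_eq_peval:
  assumes g: "prelie_hom K (free_prelie K V) A g"
    and gen: "\<And>v. v \<in> carrier V \<Longrightarrow> g (free_prelie_gen K V v) = f v"
    and t: "t \<in> pterms K V"
  shows "g (pclass K V t) = peval A f t"
proof -
  let ?F = "free_prelie K V"
  note ops = free_prelie_ops[OF A.field_axioms V]
  have lin: "linear_map K ?F A g" using g by (simp add: prelie_hom_def)
  have mem: "pclass K V s \<in> carrier ?F" if "s \<in> pterms K V" for s
    using that by (simp add: ops)
  have ga: "g (x \<oplus>\<^bsub>?F\<^esub> y) = g x \<oplus>\<^bsub>A\<^esub> g y" if "x \<in> carrier ?F" "y \<in> carrier ?F" for x y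
    using lin that by (simp add: linear_map_def)
  have gs: "g (c \<odot>\<^bsub>?F\<^esub> x) = c \<odot>\<^bsub>A\<^esub> g x" if "c \<in> carrier K" "x \<in> carrier ?F" for c x
    using lin that by (simp add: linear_map_def)
  have gm: "g (x \<otimes>\<^bsub>?F\<^esub> y) = g x \<otimes>\<^bsub>A\<^esub> g y" if "x \<in> carrier ?F" "y \<in> carrier ?F" for x y
    using g that by (simp add: prelie_hom_def)
  show ?thesis using t
  proof (induction rule: pterms.induct)
    case (1 v)
    then show ?case using gen by (simp add: free_prelie_gen_def)
  next
    case 2
    then show ?case
      using linear_map_zero[OF free_prelie_module[OF A.field_axioms V] A.module_axioms lin]
      by (simp add: ops)
  next
    case (3 s t)
    then show ?case using ga[OF mem mem, of s t] by (simp add: ops)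
  next
    case (4 c t)
    then show ?case using gs[OF _ mem, of c t] by (simp add: ops)
  next
    case (5 s t)
    then show ?case using gm[OF mem mem, of s t] by (simp add: ops)
  qed
qed

theorem free_prelie_universal_unique:
  assumes "prelie_hom K (free_prelie K V) A h" "prelie_hom K (free_prelie K V) A h'"
    and "\<And>v. v \<in> carrier V \<Longrightarrow> h (free_prelie_gen K V v) = f v"
    and "\<And>v. v \<in> carrier V \<Longrightarrow> h' (free_prelie_gen K V v) = f v"
    and "x \<in> carrier (free_prelie K V)"
  shows "h x = h' x"
proof -
  obtain t where "t \<in> pterms K V" "x = pclass K V t"
    using assms(5) by (auto simp: free_prelie_def)
  then show ?thesis
    using prelie_hom_eq_peval[of h] prelie_hom_eq_peval[of h'] assms by simp
qed

end


section \<open>Operads\<close>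

text \<open>
  The symmetric groups act on the right; for an operad of multilinear maps,
  \<open>(\<mu>\<cdot>\<sigma>)(x\<^sub>1, \<dots>, x\<^sub>n) = \<mu>(x\<^bsub>\<sigma>\<inverse>(1)\<^esub>, \<dots>, x\<^bsub>\<sigma>\<inverse>(n)\<^esub>)\<close>.
  Compatibility of \<open>\<circ>\<^sub>i\<close> with the actions then involves the two permutations below, for \<open>\<nu>\<close> of arity \<open>m\<close>:

  \<^item> \<open>inner_perm m i \<tau>\<close> is \<open>\<tau>\<close> acting on the block \<open>{i, \<dots>, i+m-1}\<close>, so that
    \<open>\<mu> \<circ>\<^sub>i (\<nu>\<cdot>\<tau>) = (\<mu> \<circ>\<^sub>i \<nu>)\<cdot>\<tau>'\<close>;
  \<^item> \<open>outer_perm m i \<sigma>\<close> is \<open>\<sigma>\<close> with the entry \<open>i\<close> blown up to this block, which is moved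
    as a whole to \<open>{\<sigma>(i), \<dots>, \<sigma>(i)+m-1}\<close>, so that
    \<open>(\<mu>\<cdot>\<sigma>) \<circ>\<^sub>i \<nu> = (\<mu> \<circ>\<^bsub>\<sigma>(i)\<^esub> \<nu>)\<cdot>\<sigma>''\<close>.
\<close>

definition inner_perm :: "nat \<Rightarrow> nat \<Rightarrow> (nat \<Rightarrow> nat) \<Rightarrow> nat \<Rightarrow> nat" where
  "inner_perm m i \<tau> p = (if i \<le> p \<and> p < i + m then i - 1 + \<tau> (p + 1 - i) else p)"

definition outer_perm :: "nat \<Rightarrow> nat \<Rightarrow> (nat \<Rightarrow> nat) \<Rightarrow> nat \<Rightarrow> nat" where
  "outer_perm m i \<sigma> p =
     (let shift = (\<lambda>q. if q < \<sigma> i then q else q + m - 1)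
      in if p < i then shift (\<sigma> p)
         else if p < i + m then \<sigma> i + (p - i)
         else shift (\<sigma> (p + 1 - m)))"

text \<open>
  \<open>act n \<sigma> \<mu>\<close> is \<open>\<mu>\<cdot>\<sigma>\<close>, and \<open>pcomp n m i \<mu> \<nu>\<close> is \<open>\<mu> \<circ>\<^sub>i \<nu>\<close> for \<open>\<mu>\<close> of arity \<open>n\<close> and \<open>\<nu>\<close> of arity \<open>m\<close>.
\<close>

locale operad = field K for K :: "('k, 'q) ring_scheme" (structure) +
  fixes P :: "nat \<Rightarrow> ('k, 'a, 'x) module_scheme"
    and act :: "nat \<Rightarrow> (nat \<Rightarrow> nat) \<Rightarrow> 'a \<Rightarrow> 'a"
    and ident :: 'a
    and pcomp :: "nat \<Rightarrow> nat \<Rightarrow> nat \<Rightarrow> 'a \<Rightarrow> 'a \<Rightarrow> 'a"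
  assumes space: "module K (P n)"
    and act_linear: "\<sigma> permutes {1..n} \<Longrightarrow> linear_map K (P n) (P n) (act n \<sigma>)"
    and act_id: "\<mu> \<in> carrier (P n) \<Longrightarrow> act n id \<mu> = \<mu>"
    and act_comp: "\<lbrakk>\<sigma> permutes {1..n}; \<tau> permutes {1..n}; \<mu> \<in> carrier (P n)\<rbrakk> \<Longrightarrow>
      act n (\<sigma> \<circ> \<tau>) \<mu> = act n \<tau> (act n \<sigma> \<mu>)"
    and ident_closed: "ident \<in> carrier (P 1)"
    and comp_bilinear: "\<lbrakk>1 \<le> i; i \<le> n\<rbrakk> \<Longrightarrow>
      bilinear_map K (P n) (P m) (P (n + m - 1)) (pcomp n m i)"
    and comp_act_right: "\<lbrakk>1 \<le> i; i \<le> n; \<mu> \<in> carrier (P n); \<nu> \<in> carrier (P m); \<tau> permutes {1..m}\<rbrakk> \<Longrightarrow>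
      pcomp n m i \<mu> (act m \<tau> \<nu>) = act (n + m - 1) (inner_perm m i \<tau>) (pcomp n m i \<mu> \<nu>)"
    and comp_act_left: "\<lbrakk>1 \<le> i; i \<le> n; \<mu> \<in> carrier (P n); \<nu> \<in> carrier (P m); \<sigma> permutes {1..n}\<rbrakk> \<Longrightarrow>
      pcomp n m i (act n \<sigma> \<mu>) \<nu> = act (n + m - 1) (outer_perm m i \<sigma>) (pcomp n m (\<sigma> i) \<mu> \<nu>)"
    and comp_sequential:
      "\<lbrakk>1 \<le> i; i \<le> l; 1 \<le> j; j \<le> m;
        \<kappa> \<in> carrier (P l); \<mu> \<in> carrier (P m); \<nu> \<in> carrier (P n)\<rbrakk> \<Longrightarrow>
      pcomp (l + m - 1) n (i - 1 + j) (pcomp l m i \<kappa> \<mu>) \<nu>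
        = pcomp l (m + n - 1) i \<kappa> (pcomp m n j \<mu> \<nu>)"
    and comp_parallel:
      "\<lbrakk>1 \<le> i; i < k; k \<le> l;
        \<kappa> \<in> carrier (P l); \<mu> \<in> carrier (P m); \<nu> \<in> carrier (P n)\<rbrakk> \<Longrightarrow>
      pcomp (l + m - 1) n (k - 1 + m) (pcomp l m i \<kappa> \<mu>) \<nu>
        = pcomp (l + n - 1) m i (pcomp l n k \<kappa> \<nu>) \<mu>"
    and ident_comp: "\<nu> \<in> carrier (P n) \<Longrightarrow> pcomp 1 n 1 ident \<nu> = \<nu>"
    and comp_ident: "\<lbrakk>1 \<le> i; i \<le> m; \<mu> \<in> carrier (P m)\<rbrakk> \<Longrightarrow> pcomp m 1 i \<mu> ident = \<mu>"

text \<open>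
  The vector space \<open>\<Oplus>\<^bsub>n \<ge> 1\<^esub> P(n)\<close>: finitely supported families \<open>f\<close> with \<open>f n \<in> P(n)\<close>, undefined at
  \<open>n = 0\<close>.  The component of \<open>f \<triangleleft> g\<close> in \<open>P(k)\<close> is the sum of \<open>f n \<circ>\<^sub>i g m\<close> over all \<open>n, m \<ge> 1\<close> with
  \<open>n + m - 1 = k\<close> and all \<open>1 \<le> i \<le> n\<close>; this is the bilinear extension of the product of
  homogeneous elements (lemma \<open>operad_prelie_mult_homogeneous\<close>).
\<close>

definition operad_prelie :: "(nat \<Rightarrow> ('k, 'a, 'x) module_scheme) \<Rightarrow>
    (nat \<Rightarrow> nat \<Rightarrow> nat \<Rightarrow> 'a \<Rightarrow> 'a \<Rightarrow> 'a) \<Rightarrow> ('k, nat \<Rightarrow> 'a) module" where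
  "operad_prelie P pcomp =
     \<lparr>carrier = {f \<in> \<Pi>\<^sub>E n\<in>{1..}. carrier (P n). finite {n\<in>{1..}. f n \<noteq> \<zero>\<^bsub>P n\<^esub>}},
      monoid.mult = (\<lambda>f g. \<lambda>k\<in>{1..}.
        \<Oplus>\<^bsub>P k\<^esub>n\<in>{1..k}. \<Oplus>\<^bsub>P k\<^esub>i\<in>{1..n}. pcomp n (k + 1 - n) i (f n) (g (k + 1 - n))),
      one = undefined,
      zero = (\<lambda>n\<in>{1..}. \<zero>\<^bsub>P n\<^esub>),
      add = (\<lambda>f g. \<lambda>n\<in>{1..}. f n \<oplus>\<^bsub>P n\<^esub> g n),
      smult = (\<lambda>c f. \<lambda>n\<in>{1..}. c \<odot>\<^bsub>P n\<^esub> f n)\<rparr>"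

definition homogeneous :: "(nat \<Rightarrow> ('k, 'a, 'x) module_scheme) \<Rightarrow> nat \<Rightarrow> 'a \<Rightarrow> nat \<Rightarrow> 'a" where
  "homogeneous P n \<mu> = (\<lambda>k\<in>{1..}. if k = n then \<mu> else \<zero>\<^bsub>P k\<^esub>)"

context operad
begin

lemma comp_closed:
  "\<lbrakk>1 \<le> i; i \<le> n; \<mu> \<in> carrier (P n); \<nu> \<in> carrier (P m)\<rbrakk> \<Longrightarrow> pcomp n m i \<mu> \<nu> \<in> carrier (P (n + m - 1))"
  using comp_bilinear[of i n m] by (auto simp: bilinear_map_def linear_map_def)

lemma comp_zero:
  assumes "1 \<le> i" "i \<le> n"
  shows "\<nu> \<in> carrier (P m) \<Longrightarrow> pcomp n m i \<zero>\<^bsub>P n\<^esub> \<nu> = \<zero>\<^bsub>P (n + m - 1)\<^esub>"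
    and "\<mu> \<in> carrier (P n) \<Longrightarrow> pcomp n m i \<mu> \<zero>\<^bsub>P m\<^esub> = \<zero>\<^bsub>P (n + m - 1)\<^esub>"
proof -
  assume "\<nu> \<in> carrier (P m)"
  then have "linear_map K (P n) (P (n + m - 1)) (\<lambda>x. pcomp n m i x \<nu>)"
    using comp_bilinear[OF assms, of m] by (simp add: bilinear_map_def)
  from linear_map_zero[OF space space this]
  show "pcomp n m i \<zero>\<^bsub>P n\<^esub> \<nu> = \<zero>\<^bsub>P (n + m - 1)\<^esub>" .
next
  assume "\<mu> \<in> carrier (P n)"
  then have "linear_map K (P m) (P (n + m - 1)) (pcomp n m i \<mu>)"
    using comp_bilinear[OF assms, of m] by (simp add: bilinear_map_def)
  from linear_map_zero[OF space space this]
  show "pcomp n m i \<mu> \<zero>\<^bsub>P m\<^esub> = \<zero>\<^bsub>P (n + m - 1)\<^esub>" .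
qed

lemma operad_prelie_mult_homogeneous:
  assumes n: "1 \<le> n" and m: "1 \<le> m" and \<mu>: "\<mu> \<in> carrier (P n)" and \<nu>: "\<nu> \<in> carrier (P m)"
  shows "homogeneous P n \<mu> \<otimes>\<^bsub>operad_prelie P pcomp\<^esub> homogeneous P m \<nu>
    = homogeneous P (n + m - 1) (\<Oplus>\<^bsub>P (n + m - 1)\<^esub>i\<in>{1..n}. pcomp n m i \<mu> \<nu>)"
proof
  fix k
  let ?f = "homogeneous P n \<mu>" and ?g = "homogeneous P m \<nu>"
  define F where
    "F = (\<lambda>a. \<Oplus>\<^bsub>P k\<^esub>i\<in>{1..a}. pcomp a (k + 1 - a) i (?f a) (?g (k + 1 - a)))"
  define S where "S = (\<Oplus>\<^bsub>P (n + m - 1)\<^esub>i\<in>{1..n}. pcomp n m i \<mu> \<nu>)"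
  interpret Pk: module K "P k" by (rule space)
  have z: "\<zero>\<^bsub>P a\<^esub> \<in> carrier (P a)" for a
  proof -
    interpret module K "P a" by (rule space)
    show ?thesis by simp
  qed
  have hf: "?f a \<in> carrier (P a)" "?g a \<in> carrier (P a)" if "1 \<le> a" for a
    using that z \<mu> \<nu> by (auto simp: homogeneous_def)
  have F0: "F a = \<zero>\<^bsub>P k\<^esub>" if p: "a \<in> {1..k}" "\<not> (a = n \<and> k = n + m - 1)" for a
  proof -
    define b where "b = k + 1 - a"
    have ab: "1 \<le> a" "1 \<le> b" "a + b - 1 = k" using p by (auto simp: b_def)
    have "pcomp a b i (?f a) (?g b) = \<zero>\<^bsub>P k\<^esub>" if i: "i \<in> {1..a}" for i
    proof (cases "a = n")
      case True
      then have "?g b = \<zero>\<^bsub>P b\<^esub>" using p ab by (auto simp: homogeneous_def)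
      then show ?thesis using comp_zero(2)[of i a "?f a" b] i ab hf by auto
    next
      case False
      then have "?f a = \<zero>\<^bsub>P a\<^esub>" using ab by (auto simp: homogeneous_def)
      then show ?thesis using comp_zero(1)[of i a "?g b" b] i ab hf by auto
    qed
    then have "F a = (\<Oplus>\<^bsub>P k\<^esub>i\<in>{1..a}. \<zero>\<^bsub>P k\<^esub>)"
      unfolding F_def b_def[symmetric] by (intro Pk.finsum_cong') auto
    then show ?thesis by (simp add: Pk.finsum_zero)
  qed
  have Fnm: "F n = S" if "k = n + m - 1"
    using that n m by (simp add: F_def S_def homogeneous_def)
  have Sc: "S \<in> carrier (P k)" if "k = n + m - 1"
    using comp_closed[OF _ _ \<mu> \<nu>] unfolding S_def that[symmetric]
    by (intro Pk.finsum_closed) auto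
  have sum: "(\<Oplus>\<^bsub>P k\<^esub>a\<in>{1..k}. F a) = (if k = n + m - 1 then S else \<zero>\<^bsub>P k\<^esub>)"
  proof (cases "k = n + m - 1")
    case True
    have "(\<Oplus>\<^bsub>P k\<^esub>a\<in>{1..k}. F a) = (\<Oplus>\<^bsub>P k\<^esub>a\<in>{1..k}. if n = a then S else \<zero>\<^bsub>P k\<^esub>)"
      using True F0 Fnm Sc z by (intro Pk.finsum_cong') auto
    also have "\<dots> = S"
      using Pk.finsum_singleton[of n "{1..k}" "\<lambda>_. S"] True n m Sc by auto
    finally show ?thesis using True by simp
  next
    case False
    then have "(\<Oplus>\<^bsub>P k\<^esub>a\<in>{1..k}. F a) = (\<Oplus>\<^bsub>P k\<^esub>a\<in>{1..k}. \<zero>\<^bsub>P k\<^esub>)"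
      using F0 n m by (intro Pk.finsum_cong') auto
    then show ?thesis using False by (simp add: Pk.finsum_zero)
  qed
  show "(?f \<otimes>\<^bsub>operad_prelie P pcomp\<^esub> ?g) k = homogeneous P (n + m - 1)
      (\<Oplus>\<^bsub>P (n + m - 1)\<^esub>i\<in>{1..n}. pcomp n m i \<mu> \<nu>) k"
    using sum unfolding S_def[symmetric]
    by (simp add: operad_prelie_def F_def homogeneous_def[of P "n + m - Suc 0"])
qed

end

end

theory Submission
  imports Defs
begin

text \<open>
  In \<open>A = \<Oplus>\<^bsub>n \<ge> 1\<^esub> P(n)\<close> the unit of the operad is a left identity, because
  \<open>id \<triangleleft> x = id \<circ>\<^sub>1 x = x\<close> (lemma \<open>ident_left_unit\<close>).  A non-zero free pre-Lie algebra \<open>F(V)\<close> has no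
  left identity \<open>e\<close>.  Indeed, \<open>V\<close> with the zero product is a pre-Lie algebra, so the identity of \<open>V\<close>
  extends to a homomorphism \<open>h : F(V) \<rightarrow> V\<close>, the projection onto the part of degree one.  For
  every \<open>x\<close> it satisfies \<open>h(x) = h(e \<triangleleft> x) = h(e) \<triangleleft> h(x) = 0\<close>.  Since \<open>h(v) = v\<close> for every generator
  \<open>v\<close>, this gives \<open>V = 0\<close> and hence \<open>F(V) = 0\<close> (lemma \<open>free_prelie_left_unit_trivial\<close>).
  An isomorphism \<open>A \<cong> F(V)\<close> would carry the left identity of \<open>A\<close> to one of \<open>F(V)\<close>, and \<open>A \<noteq> 0\<close>
  because \<open>id \<noteq> 0\<close>.
\<close>

text \<open>The vector space \<open>V\<close> with the zero product.\<close>

definition null_product :: "('k, 'v, 'x) module_scheme \<Rightarrow> ('k, 'v, 'x) module_scheme" where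
  "null_product V = V\<lparr>monoid.mult := (\<lambda>x y. \<zero>\<^bsub>V\<^esub>)\<rparr>"

lemma null_product_simps [simp]:
  "carrier (null_product V) = carrier V"
  "\<zero>\<^bsub>null_product V\<^esub> = \<zero>\<^bsub>V\<^esub>"
  "x \<oplus>\<^bsub>null_product V\<^esub> y = x \<oplus>\<^bsub>V\<^esub> y"
  "c \<odot>\<^bsub>null_product V\<^esub> x = c \<odot>\<^bsub>V\<^esub> x"
  "x \<otimes>\<^bsub>null_product V\<^esub> y = \<zero>\<^bsub>V\<^esub>"
  by (simp_all add: null_product_def)

lemma null_product_prelie:
  assumes "field K" "module K V"
  shows "prelie_algebra K (null_product V)"
proof -
  interpret field K by fact
  interpret V: module K V by fact
  have "abelian_group (null_product V)"
    by (rule abelian_groupI) (auto simp: V.a_assoc intro: V.a_comm abelian_groupE(6)[OF V.abelian_group_axioms])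
  then interpret N: module K "null_product V"
    by (rule moduleI[OF is_cring])
       (simp_all add: V.smult_l_distr V.smult_r_distr V.smult_assoc1)
  show ?thesis
    by unfold_locales (auto simp: bilinear_map_def linear_map_def)
qed

text \<open>The free pre-Lie algebra on the zero space is zero.\<close>

lemma pcong_Zero_if_trivial:
  assumes K: "field K" and V: "module K V" and triv: "carrier V = {\<zero>\<^bsub>V\<^esub>}"
    and t: "t \<in> pterms K V"
  shows "pcong K V t Zero"
  using t
proof (induction rule: pterms.induct)
  interpret field K by fact
  interpret V: module K V by fact
  note intros = pterms.intros
  have Z: "Zero \<in> pterms K V" by (rule intros)
  \<comment> \<open>Multiples of \<open>Zero\<close> and products with it vanish once \<open>Zero\<close> is written as \<open>0\<close> times itself.\<close>
  have zz: "pcong K V Zero (Scale \<zero>\<^bsub>K\<^esub> Zero)"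
    by (rule pc_sym[OF scale_0[OF Z]])
  {
    case (1 v)
    then have v: "v = \<zero>\<^bsub>V\<^esub>" using triv by simp
    have "pcong K V (Gen (\<zero>\<^bsub>K\<^esub> \<odot>\<^bsub>V\<^esub> v)) (Scale \<zero>\<^bsub>K\<^esub> (Gen v))"
      using 1 by (intro gen_scale) auto
    moreover have "pcong K V (Scale \<zero>\<^bsub>K\<^esub> (Gen v)) Zero"
      using 1 by (intro scale_0 intros)
    ultimately have "pcong K V (Gen (\<zero>\<^bsub>K\<^esub> \<odot>\<^bsub>V\<^esub> v)) Zero" by (rule pc_trans)
    then show ?case using v by simp
  next
    case 2
    show ?case by (rule pc_refl[OF Z])
  next
    case (3 s t)
    show ?case by (rule pc_trans[OF pc_Add[OF 3(3,4)] add_0[OF Z]])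
  next
    case (4 c t)
    have "pcong K V (Scale c Zero) (Scale c (Scale \<zero>\<^bsub>K\<^esub> Zero))"
      by (rule pc_Scale[OF 4(1) zz])
    moreover have "pcong K V (Scale c (Scale \<zero>\<^bsub>K\<^esub> Zero)) (Scale \<zero>\<^bsub>K\<^esub> Zero)"
      using scale_scale[OF 4(1) zero_closed Z] 4(1) by simp
    ultimately show ?case
      by (meson pc_trans pc_Scale[OF 4(1) 4(3)] scale_0[OF Z])
  next
    case (5 s t)
    have "pcong K V (Prod Zero Zero) (Prod (Scale \<zero>\<^bsub>K\<^esub> Zero) Zero)"
      by (rule pc_Prod[OF zz pc_refl[OF Z]])
    moreover have "pcong K V (Prod (Scale \<zero>\<^bsub>K\<^esub> Zero) Zero) (Scale \<zero>\<^bsub>K\<^esub> (Prod Zero Zero))"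
      by (rule prod_scale_left[OF zero_closed Z Z])
    moreover have "pcong K V (Scale \<zero>\<^bsub>K\<^esub> (Prod Zero Zero)) Zero"
      by (intro scale_0 intros)
    ultimately show ?case
      by (meson pc_trans pc_Prod[OF 5(3,4)])
  }
qed

lemma free_prelie_left_unit_trivial:
  assumes K: "field K" and V: "module K V"
    and e: "e \<in> carrier (free_prelie K V)"
    and unit: "\<And>x. x \<in> carrier (free_prelie K V) \<Longrightarrow> e \<otimes>\<^bsub>free_prelie K V\<^esub> x = x"
  shows "carrier (free_prelie K V) = {\<zero>\<^bsub>free_prelie K V\<^esub>}"
proof -
  interpret V: module K V by fact
  have "linear_map K V (null_product V) (\<lambda>v. v)"
    by (simp add: linear_map_def)
  from free_prelie_universal_exists[OF V null_product_prelie[OF K V] this]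
  obtain h where h: "prelie_hom K (free_prelie K V) (null_product V) h"
    and gen: "\<And>v. v \<in> carrier V \<Longrightarrow> h (free_prelie_gen K V v) = v"
    by blast
  have "v = \<zero>\<^bsub>V\<^esub>" if v: "v \<in> carrier V" for v
  proof -
    let ?g = "free_prelie_gen K V v"
    have g: "?g \<in> carrier (free_prelie K V)"
      using free_prelie_gen_linear[OF K V] v by (auto simp: linear_map_def)
    have "v = h (e \<otimes>\<^bsub>free_prelie K V\<^esub> ?g)" by (simp add: unit[OF g] gen[OF v])
    also have "\<dots> = \<zero>\<^bsub>V\<^esub>" using h e g by (simp add: prelie_hom_def)
    finally show ?thesis .
  qed
  then have "carrier V = {\<zero>\<^bsub>V\<^esub>}" by auto
  then have "pclass K V t = pclass K V Zero" if "t \<in> pterms K V" for t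
    using pclass_eq[OF K V] pcong_Zero_if_trivial[OF K V] that by blast
  then show ?thesis
    unfolding free_prelie_carrier[OF K V] free_prelie_zero[OF K V] by (auto intro: pterms.intros)
qed

context operad
begin

lemma homogeneous_closed:
  assumes "1 \<le> n" "\<mu> \<in> carrier (P n)"
  shows "homogeneous P n \<mu> \<in> carrier (operad_prelie P pcomp)"
proof -
  have z: "\<zero>\<^bsub>P k\<^esub> \<in> carrier (P k)" for k
  proof -
    interpret module K "P k" by (rule space)
    show ?thesis by simp
  qed
  have "{k \<in> {1..}. homogeneous P n \<mu> k \<noteq> \<zero>\<^bsub>P k\<^esub>} \<subseteq> {n}"
    by (auto simp: homogeneous_def)
  then have "finite {k \<in> {1..}. homogeneous P n \<mu> k \<noteq> \<zero>\<^bsub>P k\<^esub>}"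
    by (rule finite_subset) simp
  moreover have "homogeneous P n \<mu> \<in> (\<Pi>\<^sub>E k\<in>{1..}. carrier (P k))"
    using assms z by (auto simp: homogeneous_def)
  ultimately show ?thesis by (simp add: operad_prelie_def)
qed

lemma ident_left_unit:
  assumes "x \<in> carrier (operad_prelie P pcomp)"
  shows "homogeneous P 1 ident \<otimes>\<^bsub>operad_prelie P pcomp\<^esub> x = x"
proof
  fix k
  let ?e = "homogeneous P 1 ident"
  have x: "x \<in> (\<Pi>\<^sub>E n\<in>{1..}. carrier (P n))"
    using assms by (simp add: operad_prelie_def)
  show "(?e \<otimes>\<^bsub>operad_prelie P pcomp\<^esub> x) k = x k"
  proof (cases "1 \<le> k")
    case False
    then show ?thesis using x by (auto simp: operad_prelie_def PiE_def extensional_def)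
  next
    case k: True
    interpret Pk: module K "P k" by (rule space)
    have xc: "x n \<in> carrier (P n)" if "1 \<le> n" for n
      using x that by auto
    define F where
      "F n = (\<Oplus>\<^bsub>P k\<^esub>i\<in>{1..n}. pcomp n (k + 1 - n) i (?e n) (x (k + 1 - n)))" for n
    have "F n = (if 1 = n then x k else \<zero>\<^bsub>P k\<^esub>)" if n: "n \<in> {1..k}" for n
    proof (cases "n = 1")
      case True
      then show ?thesis
        using ident_comp[OF xc[OF k]] xc[OF k] by (simp add: F_def homogeneous_def)
    next
      case False
      have "pcomp n (k + 1 - n) i (?e n) (x (k + 1 - n)) = \<zero>\<^bsub>P k\<^esub>" if "i \<in> {1..n}" for i
        using comp_zero(1)[of i n "x (k + 1 - n)" "k + 1 - n"] that n False
          xc[of "k + 1 - n"]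
        by (simp add: homogeneous_def)
      then have "F n = (\<Oplus>\<^bsub>P k\<^esub>i\<in>{1..n}. \<zero>\<^bsub>P k\<^esub>)"
        unfolding F_def by (intro Pk.finsum_cong') auto
      then show ?thesis using False by (simp add: Pk.finsum_zero)
    qed
    then have "(\<Oplus>\<^bsub>P k\<^esub>n\<in>{1..k}. F n) = (\<Oplus>\<^bsub>P k\<^esub>n\<in>{1..k}. if 1 = n then x k else \<zero>\<^bsub>P k\<^esub>)"
      using xc[OF k] by (intro Pk.finsum_cong') auto
    also have "\<dots> = x k"
      using Pk.finsum_singleton[of 1 "{1..k}" "\<lambda>_. x k"] k xc[OF k] by auto
    finally show ?thesis using k by (simp add: operad_prelie_def F_def)
  qed
qed

end

theorem theorem3p1:
  fixes K :: "('k, 'q) ring_scheme"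
    and P :: "nat \<Rightarrow> ('k, 'a, 'x) module_scheme"
    and act :: "nat \<Rightarrow> (nat \<Rightarrow> nat) \<Rightarrow> 'a \<Rightarrow> 'a"
    and ident :: 'a
    and pcomp :: "nat \<Rightarrow> nat \<Rightarrow> nat \<Rightarrow> 'a \<Rightarrow> 'a \<Rightarrow> 'a"
  assumes "operad K P act ident pcomp"
    and "carrier (P 0) = {\<zero>\<^bsub>P 0\<^esub>}"
    and "carrier (P 1) = {c \<odot>\<^bsub>P 1\<^esub> ident | c. c \<in> carrier K}"
    and "ident \<noteq> \<zero>\<^bsub>P 1\<^esub>"
  shows "\<not> (\<exists>V :: ('k, 'v) module. module K V \<and>
              prelie_isomorphic K (operad_prelie P pcomp) (free_prelie K V))"
proof
  interpret operad K P act ident pcomp by fact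
  interpret P1: module K "P 1" by (rule space)
  let ?A = "operad_prelie P pcomp"
  let ?e = "homogeneous P 1 ident" and ?z = "homogeneous P 1 \<zero>\<^bsub>P 1\<^esub>"
  have e: "?e \<in> carrier ?A" and z: "?z \<in> carrier ?A"
    by (simp_all only: homogeneous_closed ident_closed P1.zero_closed order_refl)
  assume "\<exists>V :: ('k, 'v) module. module K V \<and> prelie_isomorphic K ?A (free_prelie K V)"
  then obtain V :: "('k, 'v) module" and f where V: "module K V"
    and f: "prelie_hom K ?A (free_prelie K V) f"
    and bij: "bij_betw f (carrier ?A) (carrier (free_prelie K V))"
    by (auto simp: prelie_isomorphic_def)
  have "f ?e \<otimes>\<^bsub>free_prelie K V\<^esub> y = y" if "y \<in> carrier (free_prelie K V)" for y
  proof -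
    have "y \<in> f ` carrier ?A"
      using that by (simp only: bij_betw_imp_surj_on[OF bij])
    then obtain x where x: "x \<in> carrier ?A" "y = f x"
      by (elim imageE)
    have "f (?e \<otimes>\<^bsub>?A\<^esub> x) = f ?e \<otimes>\<^bsub>free_prelie K V\<^esub> f x"
      using f e x(1) by (simp only: prelie_hom_def)
    then show ?thesis
      by (simp only: ident_left_unit[OF x(1)] x(2))
  qed
  then have "carrier (free_prelie K V) = {\<zero>\<^bsub>free_prelie K V\<^esub>}"
    using free_prelie_left_unit_trivial[OF field_axioms V] bij_betwE[OF bij] e by blast
  then have "f ?e = f ?z"
    using bij_betwE[OF bij] e z by blast
  then have "?e = ?z"
    using bij e z by (auto simp: bij_betw_def inj_on_def)
  then have "?e 1 = ?z 1" by (rule fun_cong)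
  then show False using assms(4) by (simp add: homogeneous_def)
qed

end
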